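(* Let $L\ge2$ and let $\mathbf f(t,\mathbf x)=\mathbf p_L(t,\mathbf x)$ be a polynomial in $\mathbf x\in\mathbb R^d$ of degree $L$, $$\mathbf p_L(t,\mathbf x)=\sum_{1\le|\alpha|\le L}[p_{1,\alpha}(t),\dots,p_{d,\alpha}(t)]^T\,\mathbf x_\alpha .$$ Let $\mathbf x(t)$ be the solution of $\dot{\mathbf x}(t)=\mathbf p_L(t,\mathbf x(t))$, $t\ge t_0$, with nonzero initial condition $\mathbf x(t_0)=\mathbf x_0\ne0$. For $R>0$ set $$D_0(\mathbf p_L,R)=\sup_{1\le k\le L}R^k\sup_{t\ge t_0}\sum_{j=1}^d\sum_{\alpha\in\mathbb Z_k^d}|p_{j,\alpha}(t)|,$$ and set $$T^*(\mathbf p_L,\mathbf x_0)=\sup_{R>e\|\mathbf x_0\|_\infty}\frac{(e-1)R}{(2e-1)D_0(\mathbf p_L,R)}\ln\left(\frac{R}{e\|\mathbf x_0\|_\infty}\right).$$ Let $\mathbf y_{1,N}(t)$ be the first block of the solution of the order-$N$ finite-section approximation of the Carleman linearization (defined in the context). Then for every $t$ with $t_0<t<t_0+T^*(\mathbf p_L,\mathbf x_0)$, $\mathbf y_{1,N}(t)$ converges exponentially to $\mathbf x(t)$ as $N\to\infty$; that is, there exist $C>0$ and $\rho\in(0,1)$ with $\|\mathbf y_{1,N}(t)-\mathbf x(t)\|_\infty\le C\rho^N$ for all $N\ge1$.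
   Context: Notation: $\mathbb Z_+^d$ is the set of $d$-dimensional vectors of non-negative integers; $|\alpha|=\alpha_1+\dots+\alpha_d$; $\mathbb Z_k^d=\{\alpha\in\mathbb Z_+^d: |\alpha|=k\}$; $\mathbf x_\alpha=x_1^{\alpha_1}\cdots x_d^{\alpha_d}$; $\mathbf e_1,\dots,\mathbf e_d$ is the standard basis of $\mathbb R^d$; $\|\mathbf x\|_\infty=\max_j|x_j|$; $e$ is Euler's number. Carleman blocks: let $f_{j,\alpha}(t)=p_{j,\alpha}(t)$ for $1\le|\alpha|\le L$, $\alpha\in\mathbb Z_+^d$, and $f_{j,\alpha}(t)=0$ for all other $\alpha\in\mathbb Z^d$; for $k,l\ge1$ let $$\mathbf A_{k,l}(t)=\Big[\sum_{j=1}^d\alpha_jf_{j,\beta-\alpha+\mathbf e_j}(t)\Big]_{\alpha\in\mathbb Z_k^d,\ \beta\in\mathbb Z_l^d}.$$ Finite-section approximation of order $N$: the finite linear system $$\dot{\mathbf y}_{k,N}(t)=\sum_{l=k}^N\mathbf A_{k,l}(t)\,\mathbf y_{l,N}(t),\qquad \mathbf y_{k,N}(t_0)=[(\mathbf x_0)_\alpha]_{\alpha\in\mathbb Z_k^d},\qquad 1\le k\le N,$$ for $t\ge t_0$, with $\mathbf y_{k,N}(t)$ indexed by $\mathbb Z_k^d$. The first block $\mathbf y_{1,N}(t)$ is identified with a vector in $\mathbb R^d$ via $\mathbb Z_1^d=\{\mathbf e_1,\dots,\mathbf e_d\}$. *)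

theory Defs
  imports "HOL-Analysis.Analysis"
begin

definition mi_size :: "nat ^ 'd \<Rightarrow> nat" where
  "mi_size \<alpha> = (\<Sum>i\<in>UNIV. \<alpha> $ i)"

definition mi_set :: "nat \<Rightarrow> (nat ^ 'd) set" where
  "mi_set k = {\<alpha>. mi_size \<alpha> = k}"

lemma finite_mi_size_le: "finite {\<alpha> :: nat ^ 'd. mi_size \<alpha> \<le> k}"
proof (rule finite_subset)
  show "{\<alpha> :: nat ^ 'd. mi_size \<alpha> \<le> k} \<subseteq> vec_lambda ` (UNIV \<rightarrow>\<^sub>E {..k})"
  proof
    fix \<alpha> :: "nat ^ 'd"
    assume "\<alpha> \<in> {\<alpha>. mi_size \<alpha> \<le> k}"
    then have le: "(\<Sum>i\<in>UNIV. \<alpha> $ i) \<le> k"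
      by (simp add: mi_size_def)
    have "\<alpha> $ i \<le> k" for i
      using member_le_sum[of i UNIV "($) \<alpha>"] le by simp
    then have "($) \<alpha> \<in> UNIV \<rightarrow>\<^sub>E {..k}"
      by auto
    then show "\<alpha> \<in> vec_lambda ` (UNIV \<rightarrow>\<^sub>E {..k})"
      by (metis image_eqI vec_nth_inverse)
  qed
  show "finite (vec_lambda ` ((UNIV :: 'd set) \<rightarrow>\<^sub>E {..k}))"
    by (intro finite_imageI finite_PiE) auto
qed

lemma finite_mi_set: "finite (mi_set k :: (nat ^ 'd) set)"
  by (rule finite_subset[OF _ finite_mi_size_le[of k]]) (auto simp: mi_set_def)

definition vmonomial :: "real ^ 'd \<Rightarrow> nat ^ 'd \<Rightarrow> real" where
  "vmonomial x \<alpha> = (\<Prod>i\<in>UNIV. (x $ i) ^ (\<alpha> $ i))"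

text \<open>Throughout, \<open>p j \<alpha> t\<close> is the coefficient of the monomial \<open>x\<^sup>\<alpha>\<close> in the \<open>j\<close>-th component
  of the field at time \<open>t\<close>; only indices with \<open>1 \<le> mi_size \<alpha> \<le> L\<close> matter.\<close>

definition poly_field ::
    "('d \<Rightarrow> nat ^ 'd \<Rightarrow> real \<Rightarrow> real) \<Rightarrow> nat \<Rightarrow> real \<Rightarrow> real ^ 'd \<Rightarrow> real ^ 'd" where
  "poly_field p L t x =
     (\<chi> j. \<Sum>\<alpha> | 1 \<le> mi_size \<alpha> \<and> mi_size \<alpha> \<le> L. p j \<alpha> t * vmonomial x \<alpha>)"

definition field_coeff ::
    "('d \<Rightarrow> nat ^ 'd \<Rightarrow> real \<Rightarrow> real) \<Rightarrow> nat \<Rightarrow> 'd \<Rightarrow> int ^ 'd \<Rightarrow> real \<Rightarrow> real" where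
  "field_coeff p L j \<gamma> t =
     (let \<alpha> = (\<chi> i. nat (\<gamma> $ i)) in
        if (\<forall>i. 0 \<le> \<gamma> $ i) \<and> 1 \<le> mi_size \<alpha> \<and> mi_size \<alpha> \<le> L then p j \<alpha> t else 0)"

text \<open>The formula for the entries does not involve the block position \<open>(k, l)\<close>: the block
  \<open>A\<^bsub>k,l\<^esub>(t)\<close> consists of the entries with \<open>\<alpha> \<in> mi_set k\<close> and \<open>\<beta> \<in> mi_set l\<close>.\<close>

definition carleman_entry ::
    "('d \<Rightarrow> nat ^ 'd \<Rightarrow> real \<Rightarrow> real) \<Rightarrow> nat \<Rightarrow> real \<Rightarrow> nat ^ 'd \<Rightarrow> nat ^ 'd \<Rightarrow> real" where
  "carleman_entry p L t \<alpha> \<beta> =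
     (\<Sum>j\<in>UNIV. real (\<alpha> $ j) *
        field_coeff p L j ((\<chi> i. int (\<beta> $ i)) - (\<chi> i. int (\<alpha> $ i)) + axis j 1) t)"

text \<open>\<open>y k t \<alpha>\<close> is the component with index \<open>\<alpha> \<in> mi_set k\<close> of the \<open>k\<close>-th block at time \<open>t\<close>;
  nothing is required of it for other \<open>\<alpha>\<close>.\<close>

definition finite_section_solution ::
    "('d \<Rightarrow> nat ^ 'd \<Rightarrow> real \<Rightarrow> real) \<Rightarrow> nat \<Rightarrow> real \<Rightarrow> real ^ 'd \<Rightarrow> nat \<Rightarrow>
     (nat \<Rightarrow> real \<Rightarrow> nat ^ 'd \<Rightarrow> real) \<Rightarrow> bool" where
  "finite_section_solution p L t0 x0 N y \<longleftrightarrow>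
     (\<forall>k\<in>{1..N}. \<forall>\<alpha>\<in>mi_set k.
        y k t0 \<alpha> = vmonomial x0 \<alpha> \<and>
        (\<forall>t\<ge>t0. ((\<lambda>s. y k s \<alpha>) has_real_derivative
            (\<Sum>l=k..N. \<Sum>\<beta>\<in>mi_set l. carleman_entry p L t \<alpha> \<beta> * y l t \<beta>))
          (at t within {t0..})))"

text \<open>\<open>axis j 1\<close> in the index type \<open>nat ^ 'd\<close> is the multi-index \<open>e\<^sub>j\<close>.\<close>

definition first_block :: "(nat \<Rightarrow> real \<Rightarrow> nat ^ 'd \<Rightarrow> real) \<Rightarrow> real \<Rightarrow> real ^ 'd" where
  "first_block y t = (\<chi> j. y 1 t (axis j 1))"

text \<open>Both suprema are taken in the extended reals, so no boundedness of the coefficients has to be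
  presupposed: unbounded coefficients give \<open>D0 = \<infinity>\<close> and \<open>Tstar = 0\<close>.\<close>

definition D0 ::
    "('d::finite \<Rightarrow> nat ^ 'd \<Rightarrow> real \<Rightarrow> real) \<Rightarrow> nat \<Rightarrow> real \<Rightarrow> real \<Rightarrow> ereal" where
  "D0 p L t0 R =
     (SUP k\<in>{1..L}. ereal (R ^ k) *
        (SUP t\<in>{t0..}. ereal (\<Sum>j\<in>UNIV. \<Sum>\<alpha>\<in>mi_set k. \<bar>p j \<alpha> t\<bar>)))"

definition Tstar ::
    "('d::finite \<Rightarrow> nat ^ 'd \<Rightarrow> real \<Rightarrow> real) \<Rightarrow> nat \<Rightarrow> real \<Rightarrow> real ^ 'd \<Rightarrow> ereal" where
  "Tstar p L t0 x0 =
     (SUP R\<in>{exp 1 * infnorm x0 <..}.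
        ereal ((exp 1 - 1) * R) / (ereal (2 * exp 1 - 1) * D0 p L t0 R) *
        ereal (ln (R / (exp 1 * infnorm x0))))"

end

theory Submission
  imports Defs
begin

text \<open>
  The proof is by majorants. Let \<open>D\<close> be the value of \<open>D0 p L t0 R\<close>, so that for each \<open>m\<close> between
  \<open>1\<close> and \<open>L\<close> the coefficients of degree \<open>m\<close> have sum at most \<open>D / R ^ m\<close>. A row \<open>\<alpha>\<close> of the block
  \<open>A\<^bsub>k,l\<^esub>\<close> then has absolute sum at most \<open>k * (D / R) * R ^ k / R ^ l\<close>, which is the entry in
  position \<open>(k, l)\<close> for \<open>V = R * v\<close> of the Carleman linearization of the scalar equation \<open>v' = (D / R) * v / (1 - v)\<close>.
  As long as \<open>v\<close> stays below some \<open>\<theta> < 1\<close>, an upper solution of this equation is given by an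
  exponential of rate \<open>c = D / (R * (1 - \<theta>))\<close>, because the geometric series satisfies
  \<open>v ^ k + v ^ (k + 1) + \<dots> < v ^ k / (1 - \<theta>)\<close>.

  Take \<open>\<kappa> > 1\<close> and two such exponentials \<open>U = V / \<kappa>\<close> and \<open>V\<close>, where \<open>U\<close> starts above the maximum
  norm of \<open>x0\<close> and \<open>V \<le> \<theta> * R\<close> on the whole interval. First, \<open>\<bar>x\<^sub>i\<bar> < U\<close>
  (\<open>solution_less_majorant\<close>). Secondly, for the order-\<open>N\<close> section the errors
  \<open>w\<^sub>\<alpha> = y\<^sub>\<alpha> - x\<^sup>\<alpha>\<close> start at zero and satisfy the truncated system driven by the discarded
  monomials \<open>x\<^sup>\<beta>\<close> with \<open>l = \<bar>\<beta>\<bar> > N\<close>. These are at most \<open>U ^ l = V ^ l / \<kappa> ^ l \<le> V ^ l / \<kappa> ^ N\<close>, so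
  that \<open>V ^ l / \<kappa> ^ N\<close> bounds the discarded terms as well as, inductively in time, the errors of degree
  \<open>l \<le> N\<close>. One geometric series therefore shows that \<open>V ^ k / \<kappa> ^ N\<close> is an upper solution for the
  errors (\<open>finite_section_error_less\<close>), and \<open>k = 1\<close> is exponential convergence with ratio
  \<open>1 / \<kappa>\<close>.

  Such a \<open>\<kappa>\<close> exists on the interval from \<open>t0\<close> to \<open>t\<close> as soon as
  \<open>infnorm x0 * exp (c * (t - t0)) < \<theta> * R\<close> (\<open>finite_section_converges\<close>). With \<open>\<theta> = 1 / e\<close> this reads
  \<open>t - t0 < (e - 1) * R / (e * D) * ln (R / (e * infnorm x0))\<close>, which is weaker than the condition in
  \<open>Tstar\<close> because \<open>e < 2 * e - 1\<close>.

  The coefficients need not be measurable in time, so the differential inequalities are not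
  integrated; both comparisons look at the first time of contact
  (\<open>strict_upper_solution_traps\<close>).
\<close>

section \<open>Trapping functions below strict upper solutions\<close>

text \<open>At the first time when some \<open>\<bar>f k\<bar>\<close> meets \<open>g k\<close> all the other bounds still hold weakly, so
  \<open>step\<close> applies and \<open>g k\<close> grows faster than \<open>\<bar>f k\<bar>\<close> there; hence the bound was already violated
  shortly before. Only pointwise derivatives enter, as suits
  coefficients that are merely bounded in time.\<close>

lemma strict_upper_solution_traps:
  fixes f g f' g' :: "'i \<Rightarrow> real \<Rightarrow> real"
  assumes fin: "finite I"
    and f: "\<And>i s. i \<in> I \<Longrightarrow> s \<in> {a..b} \<Longrightarrow> (f i has_real_derivative f' i s) (at s within {a..b})"
    and g: "\<And>i s. i \<in> I \<Longrightarrow> s \<in> {a..b} \<Longrightarrow> (g i has_real_derivative g' i s) (at s within {a..b})"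
    and init: "\<And>i. i \<in> I \<Longrightarrow> \<bar>f i a\<bar> < g i a"
    and step: "\<And>i s. i \<in> I \<Longrightarrow> s \<in> {a..b} \<Longrightarrow> (\<And>j. j \<in> I \<Longrightarrow> \<bar>f j s\<bar> \<le> g j s) \<Longrightarrow>
      \<bar>f' i s\<bar> < g' i s"
    and i: "i \<in> I" and s: "s \<in> {a..b}"
  shows "\<bar>f i s\<bar> < g i s"
proof (rule ccontr)
  assume contra: "\<not> \<bar>f i s\<bar> < g i s"
  have contf: "continuous_on {a..b} (f j)" if "j \<in> I" for j
    by (rule DERIV_continuous_on[OF f[OF that]])
  have contg: "continuous_on {a..b} (g j)" if "j \<in> I" for j
    by (rule DERIV_continuous_on[OF g[OF that]])
  define B where "B = (\<Union>j\<in>I. {a..b} \<inter> (\<lambda>s. \<bar>f j s\<bar> - g j s) -` {0..})"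
  have "closed B"
    unfolding B_def
  proof (intro closed_UN fin ballI continuous_closed_preimage)
    fix j assume "j \<in> I"
    then show "continuous_on {a..b} (\<lambda>s. \<bar>f j s\<bar> - g j s)"
      by (intro continuous_intros contf contg)
  qed auto
  moreover have "B \<subseteq> {a..b}"
    by (auto simp: B_def)
  ultimately have "compact B"
    by (metis bounded_closed_interval bounded_subset compact_eq_bounded_closed)
  moreover have "s \<in> B"
    using contra i s by (force simp: B_def)
  ultimately obtain c where c: "c \<in> B" "\<And>r. r \<in> B \<Longrightarrow> c \<le> r"
    using compact_attains_inf[of B] by auto
  then obtain k where k: "k \<in> I" "c \<in> {a..b}" "g k c \<le> \<bar>f k c\<bar>"
    by (auto simp: B_def)
  have "c \<noteq> a"
    using init k by force
  then have ac: "a < c"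
    using k by auto
  have before: "\<bar>f j r\<bar> < g j r" if "j \<in> I" "r \<in> {a..<c}" for j r
  proof (rule ccontr)
    assume "\<not> \<bar>f j r\<bar> < g j r"
    then have "r \<in> B"
      using that k by (force simp: B_def)
    then show False
      using c(2)[of r] that by auto
  qed
  have at_c: "\<bar>f j c\<bar> \<le> g j c" if "j \<in> I" for j
  proof -
    have "continuous_on (closure {a..<c}) (\<lambda>r. g j r - \<bar>f j r\<bar>)"
      using k ac by (intro continuous_intros continuous_on_subset[OF contf[OF that]]
          continuous_on_subset[OF contg[OF that]]) auto
    moreover have "c \<in> closure {a..<c}"
      using ac by simp
    ultimately have "0 \<le> g j c - \<bar>f j c\<bar>"
      by (rule continuous_ge_on_closure) (use before that in \<open>auto simp: less_imp_le\<close>)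
    then show ?thesis
      by simp
  qed
  have slope: "\<bar>f' k c\<bar> < g' k c"
    using step[OF k(1,2)] at_c by blast
  \<comment> \<open>The sign for which the graph of \<open>\<sigma> f k\<close> touches that of \<open>g k\<close>.\<close>
  define \<sigma> :: real where "\<sigma> = (if f k c \<ge> 0 then 1 else - 1)"
  then have \<sigma>: "\<bar>\<sigma>\<bar> = 1" "\<sigma> * f k c = \<bar>f k c\<bar>"
    by auto
  have deriv: "((\<lambda>r. g k r - \<sigma> * f k r) has_real_derivative (g' k c - \<sigma> * f' k c))
      (at c within {a..b})"
    by (intro DERIV_diff DERIV_cmult f g k)
  have "\<sigma> * f' k c \<le> \<bar>f' k c\<bar>"
    using \<sigma>(1) abs_ge_self[of "\<sigma> * f' k c"] by (simp add: abs_mult)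
  then have "0 < g' k c - \<sigma> * f' k c"
    using slope by simp
  from has_real_derivative_pos_inc_left[OF deriv this]
  obtain d where d: "d > 0"
    "\<And>h. h > 0 \<Longrightarrow> c - h \<in> {a..b} \<Longrightarrow> h < d \<Longrightarrow>
      g k (c - h) - \<sigma> * f k (c - h) < g k c - \<sigma> * f k c"
    by blast
  define h where "h = min (d / 2) (c - a)"
  have h: "h > 0" "h < d" "c - h \<in> {a..<c}" "c - h \<in> {a..b}"
    using d(1) ac k by (auto simp: h_def)
  have "g k (c - h) - \<sigma> * f k (c - h) < 0"
    using d(2)[of h] h \<sigma> k(3) at_c[OF k(1)] by auto
  moreover have "\<sigma> * f k (c - h) \<le> \<bar>f k (c - h)\<bar>"
    using \<sigma>(1) abs_ge_self[of "\<sigma> * f k (c - h)"] by (simp add: abs_mult)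
  ultimately show False
    using before[OF k(1) h(3)] by simp
qed

section \<open>Monomials and the Carleman blocks\<close>

lemma mi_size_add: "mi_size (\<alpha> + \<beta>) = mi_size \<alpha> + mi_size \<beta>"
  by (simp add: mi_size_def sum.distrib)

lemma mi_size_axis [simp]: "mi_size (axis j n :: nat ^ 'd) = n"
  by (simp add: mi_size_def axis_def)

lemma minus_axis_add_axis:
  assumes "\<alpha> $ j > 0"
  shows "\<alpha> - axis j 1 + axis j 1 = (\<alpha> :: nat ^ 'd)"
  using assms by (auto simp: vec_eq_iff axis_def)

lemma mi_size_minus_axis:
  assumes "\<alpha> $ j > 0"
  shows "Suc (mi_size (\<alpha> - axis j 1)) = mi_size (\<alpha> :: nat ^ 'd)"
  using mi_size_add[of "\<alpha> - axis j 1" "axis j 1"] minus_axis_add_axis[OF assms]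
  by simp

lemma vmonomial_add: "vmonomial x (\<alpha> + \<beta>) = vmonomial x \<alpha> * vmonomial x \<beta>"
  by (simp add: vmonomial_def power_add prod.distrib)

lemma vmonomial_axis [simp]: "vmonomial x (axis j n) = (x $ j) ^ n"
proof -
  have "vmonomial x (axis j n) = (\<Prod>i\<in>UNIV. if i = j then (x $ i) ^ n else 1)"
    unfolding vmonomial_def by (intro prod.cong) (auto simp: axis_def)
  then show ?thesis
    by simp
qed

lemma abs_vmonomial_le:
  assumes "\<And>i. \<bar>x $ i\<bar> \<le> U"
  shows "\<bar>vmonomial x \<alpha>\<bar> \<le> U ^ mi_size \<alpha>"
proof -
  have "\<bar>vmonomial x \<alpha>\<bar> = (\<Prod>i\<in>UNIV. \<bar>x $ i\<bar> ^ (\<alpha> $ i))"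
    by (simp add: vmonomial_def abs_prod power_abs)
  also have "\<dots> \<le> (\<Prod>i\<in>UNIV. U ^ (\<alpha> $ i))"
    using assms by (intro prod_mono) (auto intro: power_mono)
  finally show ?thesis
    by (simp add: mi_size_def power_sum)
qed

lemma has_real_derivative_vmonomial:
  assumes x: "\<And>i. ((\<lambda>s. x s $ i) has_real_derivative d i) (at s within S)"
  shows "((\<lambda>s. vmonomial (x s) \<alpha>) has_real_derivative
    (\<Sum>j\<in>UNIV. real (\<alpha> $ j) * (vmonomial (x s) (\<alpha> - axis j 1) * d j))) (at s within S)"
proof -
  have pow: "((\<lambda>s. (x s $ i) ^ (\<alpha> $ i)) has_derivative
      (\<lambda>h. (real (\<alpha> $ i) * (x s $ i) ^ (\<alpha> $ i - 1) * d i) * h)) (at s within S)" for i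
    using DERIV_power[OF x[of i], of "\<alpha> $ i"] unfolding has_field_derivative_def
    by (rule has_derivative_eq_rhs) (auto simp: ac_simps)
  have factor: "real (\<alpha> $ j) * vmonomial (x s) (\<alpha> - axis j 1) =
      real (\<alpha> $ j) * (x s $ j) ^ (\<alpha> $ j - 1) * (\<Prod>i\<in>UNIV - {j}. (x s $ i) ^ (\<alpha> $ i))" for j
  proof -
    have "vmonomial (x s) (\<alpha> - axis j 1) =
        (x s $ j) ^ (\<alpha> $ j - 1) * (\<Prod>i\<in>UNIV - {j}. (x s $ i) ^ ((\<alpha> - axis j 1) $ i))"
      unfolding vmonomial_def by (subst prod.remove[of UNIV j]) auto
    also have "(\<Prod>i\<in>UNIV - {j}. (x s $ i) ^ ((\<alpha> - axis j 1) $ i)) =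
        (\<Prod>i\<in>UNIV - {j}. (x s $ i) ^ (\<alpha> $ i))"
      by (intro prod.cong) (auto simp: axis_def)
    finally show ?thesis
      by simp
  qed
  show ?thesis
    unfolding has_field_derivative_def
  proof (rule has_derivative_eq_rhs)
    show "((\<lambda>s. vmonomial (x s) \<alpha>) has_derivative
        (\<lambda>h. \<Sum>j\<in>UNIV. (real (\<alpha> $ j) * (x s $ j) ^ (\<alpha> $ j - 1) * d j) * h *
          (\<Prod>i\<in>UNIV - {j}. (x s $ i) ^ (\<alpha> $ i)))) (at s within S)"
      unfolding vmonomial_def by (intro has_derivative_prod pow)
    show "(\<lambda>h. \<Sum>j\<in>UNIV. (real (\<alpha> $ j) * (x s $ j) ^ (\<alpha> $ j - 1) * d j) * h *
          (\<Prod>i\<in>UNIV - {j}. (x s $ i) ^ (\<alpha> $ i))) =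
        (*) (\<Sum>j\<in>UNIV. real (\<alpha> $ j) * (vmonomial (x s) (\<alpha> - axis j 1) * d j))"
      unfolding sum_distrib_right mult.assoc[symmetric] factor
      by (intro ext sum.cong) (auto simp: ac_simps)
  qed
qed

text \<open>For fixed \<open>j\<close> and \<open>\<alpha>\<close> the coefficient occurring in column \<open>\<beta>\<close> is that of \<open>\<gamma> = \<beta> - \<alpha> + e\<^sub>j\<close>.
  Summing over \<open>\<gamma>\<close> instead of \<open>\<beta>\<close> removes the integer-valued indices. The function \<open>\<phi>\<close> allows
  the same substitution both for the action on monomials and for absolute row sums; it has to
  vanish at \<open>0\<close> since most columns carry no coefficient.\<close>

lemma sum_field_coeff_shift:
  fixes \<alpha> :: "nat ^ 'd::finite" and \<phi> :: "real \<Rightarrow> nat ^ 'd \<Rightarrow> 'b::comm_monoid_add"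
  assumes pos: "\<alpha> $ j > 0" and fin: "finite S" and zero: "\<And>\<beta>. \<phi> 0 \<beta> = 0"
  shows "(\<Sum>\<beta>\<in>S. \<phi> (field_coeff p L j ((\<chi> i. int (\<beta> $ i)) - (\<chi> i. int (\<alpha> $ i)) + axis j 1) t) \<beta>) =
    (\<Sum>\<gamma> | 1 \<le> mi_size \<gamma> \<and> mi_size \<gamma> \<le> L \<and> \<alpha> - axis j 1 + \<gamma> \<in> S.
      \<phi> (p j \<gamma> t) (\<alpha> - axis j 1 + \<gamma>))"
    (is "(\<Sum>\<beta>\<in>S. \<phi> (?c \<beta>) \<beta>) = sum ?g ?G")
proof -
  define h where "h \<gamma> = \<alpha> - axis j 1 + \<gamma>" for \<gamma> :: "nat ^ 'd"
  have inj: "inj_on h ?G"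
    by (auto simp: inj_on_def h_def)
  have diff: "(\<chi> i. int (h \<gamma> $ i)) - (\<chi> i. int (\<alpha> $ i)) + axis j 1 = (\<chi> i. int (\<gamma> $ i))" for \<gamma>
    using pos by (auto simp: vec_eq_iff h_def axis_def of_nat_diff)
  have coeff: "?c (h \<gamma>) = p j \<gamma> t" if "1 \<le> mi_size \<gamma>" "mi_size \<gamma> \<le> L" for \<gamma>
    unfolding diff using that by (simp add: field_coeff_def)
  have outside: "?c \<beta> = 0" if "\<beta> \<in> S - h ` ?G" for \<beta>
  proof (rule ccontr)
    let ?d = "(\<chi> i. int (\<beta> $ i)) - (\<chi> i. int (\<alpha> $ i)) + axis j 1 :: int ^ 'd"
    define \<gamma> where "\<gamma> = (\<chi> i. nat (?d $ i))"
    assume "?c \<beta> \<noteq> 0"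
    then have nonneg: "\<And>i. 0 \<le> ?d $ i" and size: "1 \<le> mi_size \<gamma>" "mi_size \<gamma> \<le> L"
      unfolding field_coeff_def Let_def \<gamma>_def[symmetric] by (metis (full_types))+
    have "h \<gamma> $ i = \<beta> $ i" for i
    proof -
      have "int (\<gamma> $ i) = ?d $ i"
        using nonneg[of i] by (simp add: \<gamma>_def)
      then have "int (\<gamma> $ i) = int (\<beta> $ i) - int (\<alpha> $ i) + (axis j 1 :: int ^ 'd) $ i"
        by simp
      then show ?thesis
        using pos by (cases "i = j") (auto simp: h_def axis_def)
    qed
    then have "h \<gamma> = \<beta>"
      by (simp add: vec_eq_iff)
    then show False
      using that size by (auto simp: h_def)
  qed
  have "(\<Sum>\<beta>\<in>S. \<phi> (?c \<beta>) \<beta>) = (\<Sum>\<beta>\<in>h ` ?G. \<phi> (?c \<beta>) \<beta>)"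
    using fin outside by (intro sum.mono_neutral_right) (auto simp: h_def zero)
  also have "\<dots> = (\<Sum>\<gamma>\<in>?G. \<phi> (?c (h \<gamma>)) (h \<gamma>))"
    using inj by (simp add: sum.reindex)
  also have "\<dots> = sum ?g ?G"
    using coeff by (intro sum.cong) (auto simp: h_def)
  finally show ?thesis .
qed

lemma sum_mi_size_ivl:
  fixes g :: "nat ^ 'd::finite \<Rightarrow> 'b::comm_monoid_add"
  shows "(\<Sum>\<alpha> | a \<le> mi_size \<alpha> \<and> mi_size \<alpha> \<le> b. g \<alpha>) = (\<Sum>k=a..b. \<Sum>\<alpha>\<in>mi_set k. g \<alpha>)"
proof -
  have "{\<alpha> :: nat ^ 'd. a \<le> mi_size \<alpha> \<and> mi_size \<alpha> \<le> b} = (\<Union>k\<in>{a..b}. mi_set k)"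
    by (auto simp: mi_set_def)
  moreover have "sum g (\<Union>k\<in>{a..b}. mi_set k) = (\<Sum>k=a..b. sum g (mi_set k))"
    by (rule sum.UNION_disjoint) (use finite_mi_set in \<open>auto simp: mi_set_def\<close>)
  ultimately show ?thesis
    by simp
qed

text \<open>The monomials of a solution solve the Carleman system. Multiplying the field by
  \<open>x\<^bsup>\<alpha> - e\<^sub>j\<^esup>\<close> raises the degree to at most \<open>mi_size \<alpha> + L - 1\<close>, so the infinite system has finite
  rows and any larger \<open>M\<close> may serve as the last block.\<close>

lemma has_real_derivative_vmonomial_carleman:
  fixes x :: "real \<Rightarrow> real ^ 'd::finite"
  assumes x: "(x has_vector_derivative poly_field p L s (x s)) (at s within S)"
    and M: "mi_size \<alpha> + L \<le> Suc M"
  shows "((\<lambda>s. vmonomial (x s) \<alpha>) has_real_derivative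
    (\<Sum>l=mi_size \<alpha>..M. \<Sum>\<beta>\<in>mi_set l. carleman_entry p L s \<alpha> \<beta> * vmonomial (x s) \<beta>))
    (at s within S)"
proof -
  let ?B = "{\<beta> :: nat ^ 'd. mi_size \<alpha> \<le> mi_size \<beta> \<and> mi_size \<beta> \<le> M}"
  let ?c = "\<lambda>j \<beta>. field_coeff p L j ((\<chi> i. int (\<beta> $ i)) - (\<chi> i. int (\<alpha> $ i)) + axis j 1) s"
  have fin: "finite ?B"
    by (rule finite_subset[OF _ finite_mi_size_le[of M]]) auto
  have comp: "((\<lambda>s. x s $ i) has_real_derivative poly_field p L s (x s) $ i) (at s within S)" for i
    unfolding has_real_derivative_iff_has_vector_derivative
    using bounded_linear.has_vector_derivative[OF bounded_linear_vec_nth x] .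
  have "real (\<alpha> $ j) * (vmonomial (x s) (\<alpha> - axis j 1) * poly_field p L s (x s) $ j) =
      (\<Sum>\<beta>\<in>?B. real (\<alpha> $ j) * ?c j \<beta> * vmonomial (x s) \<beta>)" for j
  proof (cases "\<alpha> $ j > 0")
    case True
    have "(\<Sum>\<beta>\<in>?B. ?c j \<beta> * vmonomial (x s) \<beta>) =
        (\<Sum>\<gamma> | 1 \<le> mi_size \<gamma> \<and> mi_size \<gamma> \<le> L \<and> \<alpha> - axis j 1 + \<gamma> \<in> ?B.
          p j \<gamma> s * vmonomial (x s) (\<alpha> - axis j 1 + \<gamma>))"
      by (rule sum_field_coeff_shift[OF True fin]) simp
    also have "{\<gamma>. 1 \<le> mi_size \<gamma> \<and> mi_size \<gamma> \<le> L \<and> \<alpha> - axis j 1 + \<gamma> \<in> ?B} =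
        {\<gamma>. 1 \<le> mi_size \<gamma> \<and> mi_size \<gamma> \<le> L}"
      using M mi_size_minus_axis[OF True] by (auto simp: mi_size_add)
    also have "(\<Sum>\<gamma> | 1 \<le> mi_size \<gamma> \<and> mi_size \<gamma> \<le> L.
          p j \<gamma> s * vmonomial (x s) (\<alpha> - axis j 1 + \<gamma>)) =
        vmonomial (x s) (\<alpha> - axis j 1) * poly_field p L s (x s) $ j"
      by (simp add: poly_field_def vmonomial_add sum_distrib_left mult.left_commute)
    finally show ?thesis
      by (simp only: mult.assoc flip: sum_distrib_left)
  qed simp
  then have "(\<Sum>j\<in>UNIV. real (\<alpha> $ j) *
        (vmonomial (x s) (\<alpha> - axis j 1) * poly_field p L s (x s) $ j)) =
      (\<Sum>\<beta>\<in>?B. carleman_entry p L s \<alpha> \<beta> * vmonomial (x s) \<beta>)"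
    by (simp only: carleman_entry_def sum_distrib_right) (rule sum.swap)
  then show ?thesis
    using has_real_derivative_vmonomial[OF comp, of \<alpha>] by (simp add: sum_mi_size_ivl)
qed

text \<open>Only coefficients of degree \<open>l - k + 1\<close>, where \<open>k = mi_size \<alpha>\<close>, enter the block \<open>(k, l)\<close>, and the
  weights \<open>\<alpha>\<^sub>j\<close> add up to \<open>k\<close>. The bound \<open>k * D / R ^ (l - k + 1)\<close> is written so that
  its sum over \<open>l\<close> against \<open>V ^ l\<close> is visibly a geometric series in \<open>V / R\<close>.\<close>

lemma carleman_row_sum_le:
  fixes \<alpha> :: "nat ^ 'd::finite"
  assumes R: "R > 0" and D: "D \<ge> 0"
    and p: "\<And>m j. m \<in> {1..L} \<Longrightarrow> (\<Sum>\<gamma>\<in>mi_set m. \<bar>p j \<gamma> t\<bar>) \<le> D / R ^ m"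
    and l: "mi_size \<alpha> \<le> l"
  shows "(\<Sum>\<beta>\<in>mi_set l. \<bar>carleman_entry p L t \<alpha> \<beta>\<bar>) \<le>
    real (mi_size \<alpha>) * (D / R) * R ^ mi_size \<alpha> / R ^ l"
proof -
  let ?c = "\<lambda>j \<beta>. field_coeff p L j ((\<chi> i. int (\<beta> $ i)) - (\<chi> i. int (\<alpha> $ i)) + axis j 1) t"
  let ?m = "Suc l - mi_size \<alpha>"
  have "R * R ^ l = R ^ ?m * R ^ mi_size \<alpha>"
    using l by (simp flip: power_add power_Suc)
  then have quot: "D / R ^ ?m = (D / R) * R ^ mi_size \<alpha> / R ^ l"
    using R by (simp add: field_simps)
  have col: "real (\<alpha> $ j) * (\<Sum>\<beta>\<in>mi_set l. \<bar>?c j \<beta>\<bar>) \<le> real (\<alpha> $ j) * (D / R ^ ?m)" for j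
  proof (cases "\<alpha> $ j > 0")
    case True
    have "(\<Sum>\<beta>\<in>mi_set l. \<bar>?c j \<beta>\<bar>) =
        (\<Sum>\<gamma> | 1 \<le> mi_size \<gamma> \<and> mi_size \<gamma> \<le> L \<and> \<alpha> - axis j 1 + \<gamma> \<in> mi_set l. \<bar>p j \<gamma> t\<bar>)"
      by (rule sum_field_coeff_shift[OF True finite_mi_set]) simp
    also have "{\<gamma>. 1 \<le> mi_size \<gamma> \<and> mi_size \<gamma> \<le> L \<and> \<alpha> - axis j 1 + \<gamma> \<in> mi_set l} =
        (if ?m \<in> {1..L} then mi_set ?m else {})"
      using l mi_size_minus_axis[OF True] by (auto simp: mi_size_add mi_set_def)
    also have "(\<Sum>\<gamma>\<in>\<dots>. \<bar>p j \<gamma> t\<bar>) \<le> D / R ^ ?m"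
      using p[of ?m j] R D by auto
    finally show ?thesis
      by (rule mult_left_mono) simp
  qed simp
  have "(\<Sum>\<beta>\<in>mi_set l. \<bar>carleman_entry p L t \<alpha> \<beta>\<bar>) \<le>
      (\<Sum>\<beta>\<in>mi_set l. \<Sum>j\<in>UNIV. real (\<alpha> $ j) * \<bar>?c j \<beta>\<bar>)"
    unfolding carleman_entry_def
    by (intro sum_mono order_trans[OF sum_abs]) (simp add: abs_mult)
  also have "\<dots> = (\<Sum>j\<in>UNIV. real (\<alpha> $ j) * (\<Sum>\<beta>\<in>mi_set l. \<bar>?c j \<beta>\<bar>))"
    by (subst sum.swap) (simp add: sum_distrib_left)
  also have "\<dots> \<le> (\<Sum>j\<in>UNIV. real (\<alpha> $ j) * (D / R ^ ?m))"
    by (intro sum_mono col)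
  also have "\<dots> = real (mi_size \<alpha>) * (D / R ^ ?m)"
    by (simp only: mi_size_def of_nat_sum sum_distrib_right)
  finally show ?thesis
    by (simp add: quot)
qed

section \<open>The solution and the truncation error under a geometric majorant\<close>

lemma geometric_sum_less:
  fixes v \<theta> :: real
  assumes "0 < v" "v \<le> \<theta>" "\<theta> < 1"
  shows "(\<Sum>l=a..b. v ^ l) < v ^ a / (1 - \<theta>)"
proof -
  have "(\<Sum>l=a..b. v ^ l) < v ^ a / (1 - v)"
    using assms by (auto simp: sum_gp divide_strict_right_mono)
  also have "\<dots> \<le> v ^ a / (1 - \<theta>)"
    using assms by (intro divide_left_mono) auto
  finally show ?thesis .
qed

text \<open>Inside the box of half-width \<open>U\<close> the field has components below
  \<open>D * (\<Sum>m=1..L. (U / R) ^ m)\<close>, and the geometric series keeps this below the growth rate of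
  the exponential \<open>U\<close>.\<close>

lemma solution_less_majorant:
  fixes x :: "real \<Rightarrow> real ^ 'd::finite"
  assumes R: "R > 0" and D: "D > 0" and \<theta>: "\<theta> < 1"
    and p: "\<And>m j s. m \<in> {1..L} \<Longrightarrow> s \<in> {a..b} \<Longrightarrow> (\<Sum>\<gamma>\<in>mi_set m. \<bar>p j \<gamma> s\<bar>) \<le> D / R ^ m"
    and x: "\<And>s. s \<in> {a..b} \<Longrightarrow>
      (x has_vector_derivative poly_field p L s (x s)) (at s within {a..b})"
    and U: "\<And>s. s \<in> {a..b} \<Longrightarrow>
      (U has_real_derivative D / (R * (1 - \<theta>)) * U s) (at s within {a..b})"
    and U_bound: "\<And>s. s \<in> {a..b} \<Longrightarrow> 0 < U s \<and> U s \<le> \<theta> * R"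
    and init: "\<And>i. \<bar>x a $ i\<bar> < U a"
    and s: "s \<in> {a..b}"
  shows "\<bar>x s $ i\<bar> < U s"
proof (rule strict_upper_solution_traps[where I = UNIV and f = "\<lambda>i s. x s $ i" and g = "\<lambda>i. U"])
  fix i s
  assume s: "s \<in> {a..b}"
  show "((\<lambda>s. x s $ i) has_real_derivative poly_field p L s (x s) $ i) (at s within {a..b})"
    unfolding has_real_derivative_iff_has_vector_derivative
    using bounded_linear.has_vector_derivative[OF bounded_linear_vec_nth x[OF s]] .
  show "(U has_real_derivative D / (R * (1 - \<theta>)) * U s) (at s within {a..b})"
    by (rule U[OF s])
  assume le: "\<And>j. j \<in> UNIV \<Longrightarrow> \<bar>x s $ j\<bar> \<le> U s"
  have U0: "0 < U s"
    using U_bound[OF s] by simp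
  have "\<bar>poly_field p L s (x s) $ i\<bar> \<le>
      (\<Sum>\<gamma> | 1 \<le> mi_size \<gamma> \<and> mi_size \<gamma> \<le> L. \<bar>p i \<gamma> s\<bar> * U s ^ mi_size \<gamma>)"
    using le unfolding poly_field_def
    by (simp add: abs_mult) (intro order_trans[OF sum_abs] sum_mono,
        simp add: abs_mult mult_left_mono abs_vmonomial_le)
  also have "\<dots> = (\<Sum>m=1..L. (\<Sum>\<gamma>\<in>mi_set m. \<bar>p i \<gamma> s\<bar>) * U s ^ m)"
    by (simp only: sum_mi_size_ivl sum_distrib_right) (simp add: mi_set_def)
  also have "\<dots> \<le> (\<Sum>m=1..L. D / R ^ m * U s ^ m)"
    using p s U0 by (intro sum_mono mult_right_mono) auto
  also have "\<dots> = D * (\<Sum>m=1..L. (U s / R) ^ m)"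
    by (simp add: sum_distrib_left power_divide)
  also have "\<dots> < D * ((U s / R) ^ 1 / (1 - \<theta>))"
    using R D \<theta> U_bound[OF s]
    by (intro mult_strict_left_mono geometric_sum_less) (auto simp: field_simps)
  finally show "\<bar>poly_field p L s (x s) $ i\<bar> < D / (R * (1 - \<theta>)) * U s"
    by simp
qed (use init s in auto)

text \<open>The error at the monomials of degree at most \<open>N\<close> is compared with \<open>V ^ k / \<kappa> ^ N\<close>. The
  gap \<open>\<kappa>\<close> between the solution and \<open>V\<close> is what makes the discarded monomials as small as the
  error bound itself.\<close>

lemma finite_section_error_less:
  fixes x :: "real \<Rightarrow> real ^ 'd::finite"
  assumes R: "R > 0" and D: "D > 0" and \<theta>: "\<theta> < 1"
    and p: "\<And>m j s. m \<in> {1..L} \<Longrightarrow> s \<in> {a..b} \<Longrightarrow> (\<Sum>\<gamma>\<in>mi_set m. \<bar>p j \<gamma> s\<bar>) \<le> D / R ^ m"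
    and x: "\<And>s. s \<in> {a..b} \<Longrightarrow>
      (x has_vector_derivative poly_field p L s (x s)) (at s within {a..b})"
    and y: "finite_section_solution p L a (x a) N y"
    and V: "\<And>s. s \<in> {a..b} \<Longrightarrow>
      (V has_real_derivative D / (R * (1 - \<theta>)) * V s) (at s within {a..b})"
    and V_bound: "\<And>s. s \<in> {a..b} \<Longrightarrow> 0 < V s \<and> V s \<le> \<theta> * R"
    and \<kappa>: "\<kappa> \<ge> 1"
    and x_le: "\<And>s i. s \<in> {a..b} \<Longrightarrow> \<bar>x s $ i\<bar> \<le> V s / \<kappa>"
    and \<alpha>: "mi_size \<alpha> \<in> {1..N}" and s: "s \<in> {a..b}"
  shows "\<bar>y (mi_size \<alpha>) s \<alpha> - vmonomial (x s) \<alpha>\<bar> < V s ^ mi_size \<alpha> / \<kappa> ^ N"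
proof -
  define I where "I = {\<alpha> :: nat ^ 'd. 1 \<le> mi_size \<alpha> \<and> mi_size \<alpha> \<le> N}"
  define y' where "y' \<alpha> s =
    (\<Sum>l=mi_size \<alpha>..N. \<Sum>\<beta>\<in>mi_set l. carleman_entry p L s \<alpha> \<beta> * y l s \<beta>)" for \<alpha> s
  define z' where "z' \<alpha> s = (\<Sum>l=mi_size \<alpha>..N + L. \<Sum>\<beta>\<in>mi_set l.
    carleman_entry p L s \<alpha> \<beta> * vmonomial (x s) \<beta>)" for \<alpha> s
  show ?thesis
  proof (rule strict_upper_solution_traps[where I = I and a = a and b = b and i = \<alpha> and
        f = "\<lambda>\<alpha> s. y (mi_size \<alpha>) s \<alpha> - vmonomial (x s) \<alpha>" and
        g = "\<lambda>\<alpha> s. V s ^ mi_size \<alpha> / \<kappa> ^ N"])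
    show "finite I"
      unfolding I_def by (rule finite_subset[OF _ finite_mi_size_le[of N]]) auto
    show "\<alpha> \<in> I" "s \<in> {a..b}"
      using \<alpha> s by (auto simp: I_def)
  next
    fix \<alpha> assume \<alpha>: "\<alpha> \<in> I"
    have "y (mi_size \<alpha>) a \<alpha> = vmonomial (x a) \<alpha>"
      using y \<alpha> by (auto simp: finite_section_solution_def mi_set_def I_def)
    then show "\<bar>y (mi_size \<alpha>) a \<alpha> - vmonomial (x a) \<alpha>\<bar> < V a ^ mi_size \<alpha> / \<kappa> ^ N"
      using V_bound[of a] s \<kappa> by simp
  next
    fix \<alpha> s assume \<alpha>: "\<alpha> \<in> I" and s: "s \<in> {a..b}"
    let ?k = "mi_size \<alpha>"
    have "((\<lambda>s. y ?k s \<alpha>) has_real_derivative y' \<alpha> s) (at s within {a..})"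
      using y \<alpha> s by (auto simp: finite_section_solution_def mi_set_def I_def y'_def)
    then have "((\<lambda>s. y ?k s \<alpha>) has_real_derivative y' \<alpha> s) (at s within {a..b})"
      by (rule DERIV_subset) auto
    moreover have "((\<lambda>s. vmonomial (x s) \<alpha>) has_real_derivative z' \<alpha> s) (at s within {a..b})"
      unfolding z'_def using \<alpha>
      by (intro has_real_derivative_vmonomial_carleman x s) (auto simp: I_def)
    ultimately show "((\<lambda>s. y ?k s \<alpha> - vmonomial (x s) \<alpha>) has_real_derivative
        (y' \<alpha> s - z' \<alpha> s)) (at s within {a..b})"
      by (rule DERIV_diff)
    have "((\<lambda>s. V s ^ ?k) has_real_derivative
        (real ?k * (D / (R * (1 - \<theta>)) * V s * V s ^ (?k - Suc 0)))) (at s within {a..b})"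
      using DERIV_power[OF V[OF s], of ?k] by (simp add: ac_simps)
    moreover have "V s * V s ^ (?k - Suc 0) = V s ^ ?k"
      using \<alpha> by (cases ?k) (auto simp: I_def)
    ultimately have "((\<lambda>s. V s ^ ?k) has_real_derivative
        (real ?k * (D / (R * (1 - \<theta>)) * V s ^ ?k))) (at s within {a..b})"
      by (simp only: mult.assoc)
    then show "((\<lambda>s. V s ^ ?k / \<kappa> ^ N) has_real_derivative
        (real ?k * (D / (R * (1 - \<theta>)) * V s ^ ?k) / \<kappa> ^ N)) (at s within {a..b})"
      by (rule DERIV_cdivide)
    assume le: "\<And>\<beta>. \<beta> \<in> I \<Longrightarrow>
      \<bar>y (mi_size \<beta>) s \<beta> - vmonomial (x s) \<beta>\<bar> \<le> V s ^ mi_size \<beta> / \<kappa> ^ N"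
    \<comment> \<open>Extending the section by \<open>0\<close> beyond degree \<open>N\<close> turns the discarded terms into errors, so
      the derivative of each error is a full row of the Carleman system applied to the errors.\<close>
    define w where "w l \<beta> = (if l \<le> N then y l s \<beta> else 0) - vmonomial (x s) \<beta>" for l \<beta>
    have w_le: "\<bar>w l \<beta>\<bar> \<le> V s ^ l / \<kappa> ^ N" if \<beta>: "\<beta> \<in> mi_set l" and l: "?k \<le> l" for l \<beta>
    proof (cases "l \<le> N")
      case True
      then show ?thesis
        using le[of \<beta>] \<alpha> \<beta> l by (auto simp: w_def I_def mi_set_def)
    next
      case False
      have "\<bar>w l \<beta>\<bar> \<le> (V s / \<kappa>) ^ mi_size \<beta>"
        using False abs_vmonomial_le[OF x_le[OF s]] by (simp add: w_def)
      also have "\<dots> = V s ^ l / \<kappa> ^ l"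
        using \<beta> by (simp add: power_divide mi_set_def)
      also have "\<dots> \<le> V s ^ l / \<kappa> ^ N"
        using False \<kappa> V_bound[OF s] by (intro divide_left_mono power_increasing) auto
      finally show ?thesis .
    qed
    have "y' \<alpha> s = (\<Sum>l=?k..N + L. \<Sum>\<beta>\<in>mi_set l.
        carleman_entry p L s \<alpha> \<beta> * (if l \<le> N then y l s \<beta> else 0))"
      unfolding y'_def by (intro sum.mono_neutral_cong_left) (auto simp: finite_mi_set)
    then have "y' \<alpha> s - z' \<alpha> s =
        (\<Sum>l=?k..N + L. \<Sum>\<beta>\<in>mi_set l. carleman_entry p L s \<alpha> \<beta> * w l \<beta>)"
      by (simp only: z'_def w_def sum_subtractf right_diff_distrib)
    also have "\<bar>\<dots>\<bar> \<le> (\<Sum>l=?k..N + L. \<Sum>\<beta>\<in>mi_set l.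
        \<bar>carleman_entry p L s \<alpha> \<beta>\<bar> * (V s ^ l / \<kappa> ^ N))"
      by (intro order_trans[OF sum_abs] sum_mono, unfold abs_mult,
          intro mult_left_mono w_le) auto
    also have "\<dots> \<le> (\<Sum>l=?k..N + L.
        (real ?k * (D / R) * R ^ ?k / R ^ l) * (V s ^ l / \<kappa> ^ N))"
      unfolding sum_distrib_right[symmetric]
      using R D p[OF _ s] \<kappa> V_bound[OF s]
      by (intro sum_mono mult_right_mono carleman_row_sum_le) auto
    also have "\<dots> = real ?k * (D / R) * R ^ ?k / \<kappa> ^ N * (\<Sum>l=?k..N + L. (V s / R) ^ l)"
      unfolding sum_distrib_left by (intro sum.cong) (auto simp: power_divide ac_simps)
    also have "\<dots> < real ?k * (D / R) * R ^ ?k / \<kappa> ^ N * ((V s / R) ^ ?k / (1 - \<theta>))"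
      using R D \<theta> \<kappa> \<alpha> V_bound[OF s]
      by (intro mult_strict_left_mono geometric_sum_less) (auto simp: field_simps I_def)
    also have "\<dots> = real ?k * (D / (R * (1 - \<theta>)) * V s ^ ?k) / \<kappa> ^ N"
      using R by (simp add: power_divide)
    finally show "\<bar>y' \<alpha> s - z' \<alpha> s\<bar> < real ?k * (D / (R * (1 - \<theta>)) * V s ^ ?k) / \<kappa> ^ N" .
  qed
qed

text \<open>The smallness condition leaves room for the factor \<open>\<kappa>\<close> twice: once between the initial value
  and the majorant of the solution, which must be strict, and once more between that majorant and
  \<open>V\<close>. Hence \<open>\<kappa>\<close> is chosen such that \<open>\<kappa>\<^sup>2\<close> uses up the room exactly and \<open>V t = \<theta> * R\<close>.\<close>

theorem finite_section_converges:
  fixes x :: "real \<Rightarrow> real ^ 'd::finite"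
  assumes R: "R > 0" and D: "D > 0" and \<theta>: "0 < \<theta>" "\<theta> < 1" and t: "t0 \<le> t"
    and p: "\<And>m j s. m \<in> {1..L} \<Longrightarrow> t0 \<le> s \<Longrightarrow> (\<Sum>\<gamma>\<in>mi_set m. \<bar>p j \<gamma> s\<bar>) \<le> D / R ^ m"
    and x: "\<And>s. s \<in> {t0..t} \<Longrightarrow>
      (x has_vector_derivative poly_field p L s (x s)) (at s within {t0..t})"
    and x0: "x t0 \<noteq> 0"
    and y: "\<And>N. N \<ge> 1 \<Longrightarrow> finite_section_solution p L t0 (x t0) N (y N)"
    and small: "infnorm (x t0) * exp (D / (R * (1 - \<theta>)) * (t - t0)) < \<theta> * R"
  shows "\<exists>C>0. \<exists>\<rho>. 0 < \<rho> \<and> \<rho> < 1 \<and> (\<forall>N\<ge>1. infnorm (first_block (y N) t - x t) \<le> C * \<rho> ^ N)"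
proof -
  define c where "c = D / (R * (1 - \<theta>))"
  define q where "q = infnorm (x t0)"
  define \<kappa> where "\<kappa> = sqrt (\<theta> * R / (q * exp (c * (t - t0))))"
  define V where "V s = \<kappa>\<^sup>2 * q * exp (c * (s - t0))" for s
  have q: "q > 0"
    using x0 by (simp add: q_def infnorm_pos_lt)
  have c: "c > 0"
    using R D \<theta> by (simp add: c_def)
  have "1 < \<theta> * R / (q * exp (c * (t - t0)))"
    using small q by (simp add: c_def q_def)
  then have \<kappa>: "\<kappa> > 1" and \<kappa>2: "\<kappa>\<^sup>2 = \<theta> * R / (q * exp (c * (t - t0)))"
    by (simp_all add: \<kappa>_def)
  have V_end: "V t = \<theta> * R"
    using q by (simp add: V_def \<kappa>2)
  have V_bound: "0 < V s \<and> V s \<le> \<theta> * R" if "s \<in> {t0..t}" for s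
    using that q c \<kappa> unfolding V_end[symmetric] by (simp add: V_def)
  have V_deriv: "(V has_real_derivative c * V s) (at s within S)" for s S
    unfolding V_def by (auto intro!: derivative_eq_intros)
  have x_le: "\<bar>x s $ i\<bar> < V s / \<kappa>" if "s \<in> {t0..t}" for s i
  proof (rule solution_less_majorant[OF R D \<theta>(2) _ x _ _ _ that])
    fix s assume s: "s \<in> {t0..t}"
    show "((\<lambda>s. V s / \<kappa>) has_real_derivative D / (R * (1 - \<theta>)) * (V s / \<kappa>)) (at s within {t0..t})"
      using DERIV_cdivide[OF V_deriv, of \<kappa>] by (simp add: c_def)
    have "V s / \<kappa> \<le> V s / 1"
      using \<kappa> V_bound[OF s] by (intro divide_left_mono) auto
    then show "0 < V s / \<kappa> \<and> V s / \<kappa> \<le> \<theta> * R"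
      using \<kappa> V_bound[OF s] by auto
  next
    fix i
    have "\<bar>x t0 $ i\<bar> \<le> q"
      unfolding q_def by (rule component_le_infnorm_cart)
    also have "q < \<kappa> * q"
      using \<kappa> q by simp
    finally show "\<bar>x t0 $ i\<bar> < V t0 / \<kappa>"
      using \<kappa> by (simp add: V_def power2_eq_square)
  qed (use p in auto)
  have "infnorm (first_block (y N) t - x t) \<le> V t * (1 / \<kappa>) ^ N" if N: "N \<ge> 1" for N
  proof -
    have "\<bar>y N (mi_size \<alpha>) t \<alpha> - vmonomial (x t) \<alpha>\<bar> < V t ^ mi_size \<alpha> / \<kappa> ^ N"
      if "mi_size \<alpha> \<in> {1..N}" for \<alpha>
      using p x_le t \<kappa> V_deriv
      by (intro finite_section_error_less[OF R D \<theta>(2) _ x y[OF N] _ V_bound _ _ that])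
        (auto simp: less_imp_le c_def)
    from this[of "axis j 1" for j]
    have "\<bar>(first_block (y N) t - x t) $ j\<bar> \<le> V t * (1 / \<kappa>) ^ N" for j
      using N by (simp add: first_block_def power_divide less_imp_le)
    then show ?thesis
      unfolding infnorm_cart by (intro cSup_least) auto
  qed
  then show ?thesis
    using V_bound[of t] t \<kappa> by (intro exI[of _ "V t"] conjI exI[of _ "1 / \<kappa>"]) auto
qed

section \<open>The time horizon\<close>

theorem corollary3p3:
  fixes p :: "'d::finite \<Rightarrow> nat ^ 'd \<Rightarrow> real \<Rightarrow> real"
    and L :: nat
    and t0 :: real
    and x0 :: "real ^ 'd"
    and x :: "real \<Rightarrow> real ^ 'd"
    and y :: "nat \<Rightarrow> nat \<Rightarrow> real \<Rightarrow> nat ^ 'd \<Rightarrow> real"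
  assumes "L \<ge> 2"
    and degree: "\<exists>s\<ge>t0. \<exists>j. \<exists>\<alpha>\<in>mi_set L. p j \<alpha> s \<noteq> 0"
    and "x0 \<noteq> 0"
    and x_init: "x t0 = x0"
    and x_ode: "\<And>s. t0 \<le> s \<Longrightarrow> ereal s < ereal t0 + Tstar p L t0 x0 \<Longrightarrow>
      (x has_vector_derivative poly_field p L s (x s))
        (at s within {r. t0 \<le> r \<and> ereal r < ereal t0 + Tstar p L t0 x0})"
    and y_sol: "\<And>N. N \<ge> 1 \<Longrightarrow> finite_section_solution p L t0 x0 N (y N)"
  shows "\<forall>t. t0 < t \<and> ereal t < ereal t0 + Tstar p L t0 x0 \<longrightarrow>
    (\<exists>C>0. \<exists>\<rho>. 0 < \<rho> \<and> \<rho> < 1 \<and>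
      (\<forall>N\<ge>1. infnorm (first_block (y N) t - x t) \<le> C * \<rho> ^ N))"
proof (intro allI impI)
  fix t
  assume t: "t0 < t \<and> ereal t < ereal t0 + Tstar p L t0 x0"
  define q where "q = infnorm x0"
  have q: "q > 0"
    using \<open>x0 \<noteq> 0\<close> by (simp add: q_def infnorm_pos_lt)
  let ?e = "exp 1 :: real"
  have e: "?e > 1"
    by simp
  have "ereal (t - t0) < Tstar p L t0 x0"
    using t by (cases "Tstar p L t0 x0") auto
  then obtain R where R: "R > ?e * q"
    and less: "ereal (t - t0) < ereal ((?e - 1) * R) / (ereal (2 * ?e - 1) * D0 p L t0 R) *
      ereal (ln (R / (?e * q)))"
    unfolding Tstar_def less_SUP_iff q_def by auto
  have R0: "R > 0"
    using R q by (smt (verit) exp_gt_zero mult_pos_pos)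
  have R_le: "ereal (R ^ m) * ereal (\<Sum>j\<in>UNIV. \<Sum>\<alpha>\<in>mi_set m. \<bar>p j \<alpha> s\<bar>) \<le> D0 p L t0 R"
    if "m \<in> {1..L}" "t0 \<le> s" for m s
    unfolding D0_def using that R0
    by (intro SUP_upper2[of m] ereal_mult_left_mono SUP_upper2[of s]) auto
  have "0 \<le> ereal (R ^ L) * ereal (\<Sum>j\<in>UNIV. \<Sum>\<alpha>\<in>mi_set L. \<bar>p j \<alpha> t0\<bar>)"
    using R0 by (simp add: sum_nonneg)
  also have "\<dots> \<le> D0 p L t0 R"
    using \<open>L \<ge> 2\<close> by (intro R_le) auto
  finally have D0_nonneg: "0 \<le> D0 p L t0 R" .
  moreover have "D0 p L t0 R \<noteq> \<infinity>"
  proof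
    \<comment> \<open>Division by \<open>\<infinity>\<close> gives \<open>0\<close>, but the value of the expression at \<open>R\<close> exceeds \<open>t - t0 > 0\<close>.\<close>
    assume "D0 p L t0 R = \<infinity>"
    moreover have "ereal (2 * ?e - 1) * \<infinity> = \<infinity>"
      using e less_trans[OF _ e, of "1 / 2"] by (simp add: ereal_mult_infty)
    ultimately show False
      using less t by (simp only:) simp
  qed
  ultimately obtain D where D0: "D0 p L t0 R = ereal D" "D \<ge> 0"
    by (cases "D0 p L t0 R") auto
  have sum_le: "(\<Sum>j\<in>UNIV. \<Sum>\<alpha>\<in>mi_set m. \<bar>p j \<alpha> s\<bar>) \<le> D / R ^ m" if "m \<in> {1..L}" "t0 \<le> s" for m s
    using R_le[OF that] R0 by (simp add: D0 field_simps)
  have p_le: "(\<Sum>\<alpha>\<in>mi_set m. \<bar>p j \<alpha> s\<bar>) \<le> D / R ^ m" if "m \<in> {1..L}" "t0 \<le> s" for m j s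
    using sum_le[OF that] member_le_sum[of j UNIV "\<lambda>j. \<Sum>\<alpha>\<in>mi_set m. \<bar>p j \<alpha> s\<bar>"]
    by (simp add: sum_nonneg)
  \<comment> \<open>A nonzero coefficient of top degree makes \<open>D\<close> positive.\<close>
  obtain s j \<alpha> where nonzero: "s \<ge> t0" "\<alpha> \<in> mi_set L" "p j \<alpha> s \<noteq> 0"
    using degree by auto
  have "0 < \<bar>p j \<alpha> s\<bar>"
    using nonzero by simp
  also have "\<dots> \<le> (\<Sum>\<alpha>\<in>mi_set L. \<bar>p j \<alpha> s\<bar>)"
    using nonzero finite_mi_set by (intro member_le_sum) auto
  also have "\<dots> \<le> D / R ^ L"
    using \<open>L \<ge> 2\<close> nonzero by (intro p_le) auto
  finally have D: "D > 0"
    using R0 by (simp add: zero_less_divide_iff)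
  define \<tau> where "\<tau> = ln (R / (?e * q))"
  have \<tau>: "\<tau> > 0"
    unfolding \<tau>_def using R q by (intro ln_gt_zero) (simp add: field_simps)
  have time: "t - t0 < (?e - 1) * R / ((2 * ?e - 1) * D) * \<tau>"
    using less D e by (simp add: D0 \<tau>_def)
  \<comment> \<open>For \<open>\<theta> = 1 / ?e\<close> the majorant started at \<open>q\<close> reaches \<open>\<theta> * R\<close> when rate times elapsed time is \<open>\<tau>\<close>;
    the bound on \<open>t\<close> uses at most the fraction \<open>?e / (2 * ?e - 1)\<close> of that.\<close>
  have "D / (R * (1 - 1 / ?e)) * (t - t0) <
      D / (R * (1 - 1 / ?e)) * ((?e - 1) * R / ((2 * ?e - 1) * D) * \<tau>)"
    using D R0 by (intro mult_strict_left_mono[OF time]) auto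
  also have "\<dots> = ?e / (2 * ?e - 1) * \<tau>"
    using D R0 e by (simp add: divide_simps)
  also have "\<dots> \<le> 1 * \<tau>"
  proof (rule mult_right_mono)
    show "?e / (2 * ?e - 1) \<le> 1"
      by (subst divide_le_eq_1_pos) (use e in linarith)+
  qed (use \<tau> in simp)
  finally have "exp (D / (R * (1 - 1 / ?e)) * (t - t0)) < exp \<tau>"
    by simp
  also have "\<dots> = R / (?e * q)"
    using R0 q by (simp add: \<tau>_def)
  finally have "exp (D / (R * (1 - 1 / ?e)) * (t - t0)) < R / (?e * q)" .
  then have small: "infnorm (x t0) * exp (D / (R * (1 - 1 / ?e)) * (t - t0)) < 1 / ?e * R"
    using q by (simp add: x_init flip: q_def) (simp add: field_simps)
  have before: "t0 \<le> s \<and> ereal s < ereal t0 + Tstar p L t0 x0" if "s \<in> {t0..t}" for s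
    using that t by (auto intro: le_less_trans[of "ereal s" "ereal t"])
  have x: "(x has_vector_derivative poly_field p L s (x s)) (at s within {t0..t})"
    if "s \<in> {t0..t}" for s
    using before that by (intro has_vector_derivative_within_subset[OF x_ode]) auto
  show "\<exists>C>0. \<exists>\<rho>. 0 < \<rho> \<and> \<rho> < 1 \<and>
      (\<forall>N\<ge>1. infnorm (first_block (y N) t - x t) \<le> C * \<rho> ^ N)"
    using \<open>x0 \<noteq> 0\<close> y_sol t
    by (intro finite_section_converges[OF R0 D _ _ _ p_le x _ _ small]) (auto simp: x_init)
qed

end
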